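(* Let $\mathbf{f}=(f(i))_{i\ge 0}$ be the Fibonacci word. For every integer $c\ge 0$ there is an msd-first Fibonacci DFAO with $O(\log c)$ states that generates the shifted Fibonacci word $(f(i+c))_{i\ge 0}$ (that is, there is an absolute constant $K$ such that for all $c\ge 2$ the DFAO can be chosen with at most $K\log c$ states).
   Context: Fibonacci numbers: $F_0=0$, $F_1=1$, $F_i=F_{i-1}+F_{i-2}$ for $i\ge 2$. Zeckendorf representation: every integer $n\ge 0$ is uniquely written as $n=\sum_{2\le i\le t}a_iF_i$ with $a_i\in\{0,1\}$ and no two consecutive $a_i$ equal to $1$. The msd-first (most-significant-digit-first) representation is the word $(n)_F=a_ta_{t-1}\cdots a_2$. A binary word is a valid representation iff it does not contain $11$. Fibonacci word: $\mathbf{f}=f(0)f(1)f(2)\cdots=01001010\cdots$ is the infinite fixed point, starting with $0$, of the morphism $0\mapsto 01$, $1\mapsto 0$; equivalently $f(i)$ is the last (least significant) digit $a_2$ of the Zeckendorf representation of $i$. DFAO: a deterministic finite automaton with output is a 6-tuple $M=(Q,\Sigma,\delta,q_0,\Delta,\tau)$, with $Q$ a finite nonempty set of states, $\Sigma$ the input alphabet (here $\{0,1\}$), $\delta$ the transition function on $Q\times\Sigma$, extended to $Q\times\Sigma^*$ in the usual way, $q_0$ the initial state, $\Delta$ a finite nonempty output alphabet (here $\{0,1\}$), and $\tau:Q\to\Delta$ the output function. Convention: inputs that are not valid Zeckendorf representations (those containing $11$) do not reach any state and produce no output (so $\delta$ is partial). An msd-first Fibonacci DFAO generates a sequence $(a(i))_{i\ge0}$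 if, for every $i\ge 0$, on reading the msd-first Zeckendorf representation of $i$, preceded by any number of leading zeros, it reaches a state $q$ with $\tau(q)=a(i)$. *)

theory Defs
  imports
    Complex_Main
    "HOL-Number_Theory.Fib"
    "HOL-Library.Sublist"
begin

section \<open>The Fibonacci word\<close>

fun fib_letter :: "nat \<Rightarrow> nat list" where
  "fib_letter 0 = [0, 1]"
| "fib_letter (Suc _) = [0]"

definition fib_morphism :: "nat list \<Rightarrow> nat list" where
  "fib_morphism w = concat (map fib_letter w)"

text \<open>
  The infinite fixed point starting with 0 is the limit of the iterates of the morphism on the
  word 0: each iterate is a prefix of the next one, and the \<open>i\<close>-th one has length greater
  than \<open>i\<close>.  The lemmas \<open>fib_word_0\<close>, \<open>fib_word_fixed_point\<close> and
  \<open>fib_word_unique\<close> below confirm that this is the fixed point starting with 0.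
\<close>

definition fib_word :: "nat \<Rightarrow> nat" where
  "fib_word i = ((fib_morphism ^^ i) [0]) ! i"

lemma fib_morphism_append: "fib_morphism (u @ v) = fib_morphism u @ fib_morphism v"
  by (simp add: fib_morphism_def)

lemma fib_morphism_funpow_append:
  "(fib_morphism ^^ k) (u @ v) = (fib_morphism ^^ k) u @ (fib_morphism ^^ k) v"
  by (induction k) (simp_all add: fib_morphism_append)

lemma fib_iterate_Suc_Suc:
  "(fib_morphism ^^ Suc (Suc k)) [0] = (fib_morphism ^^ Suc k) [0] @ (fib_morphism ^^ k) [0]"
proof -
  have "(fib_morphism ^^ Suc (Suc k)) [0] = (fib_morphism ^^ Suc k) ([0] @ [1])"
    by (simp add: funpow_swap1 fib_morphism_def)
  also have "\<dots> = (fib_morphism ^^ Suc k) [0] @ (fib_morphism ^^ Suc k) [1]"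
    by (rule fib_morphism_funpow_append)
  also have "(fib_morphism ^^ Suc k) [1] = (fib_morphism ^^ k) [0]"
    by (simp add: funpow_swap1 fib_morphism_def)
  finally show ?thesis .
qed

lemma fib_iterate_prefix_Suc:
  "prefix ((fib_morphism ^^ k) [0]) ((fib_morphism ^^ Suc k) [0])"
proof (cases k)
  case 0
  then show ?thesis by (simp add: fib_morphism_def)
next
  case (Suc m)
  then show ?thesis by (simp only: fib_iterate_Suc_Suc) simp
qed

lemma fib_iterate_prefix:
  assumes "k \<le> m"
  shows "prefix ((fib_morphism ^^ k) [0]) ((fib_morphism ^^ m) [0])"
  using assms
proof (induction m rule: dec_induct)
  case (step m)
  then show ?case using fib_iterate_prefix_Suc[of m] by (meson prefix_order.trans)
qed simp

lemma fib_iterate_length: "length ((fib_morphism ^^ k) [0]) = fib (k + 2)"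
proof (induction k rule: fib.induct)
  case 2
  then show ?case by (simp add: fib_morphism_def numeral_eq_Suc)
next
  case (3 n)
  have "length ((fib_morphism ^^ Suc (Suc n)) [0]) = fib (Suc n + 2) + fib (n + 2)"
    by (simp only: fib_iterate_Suc_Suc length_append 3)
  then show ?case by simp
qed (simp_all add: numeral_eq_Suc)

lemma fib_iterate_long: "k < length ((fib_morphism ^^ k) [0])"
  unfolding fib_iterate_length
proof (induction k)
  case (Suc k)
  have "fib (Suc k + 2) = fib (k + 2) + fib (Suc k)" by simp
  moreover have "fib (Suc k) > 0" by (rule fib_neq_0_nat) simp
  ultimately show ?case using Suc.IH by linarith
qed simp

lemma fib_iterate_eq_map:
  "(fib_morphism ^^ k) [0] = map fib_word [0..<length ((fib_morphism ^^ k) [0])]"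
proof (rule nth_equalityI)
  fix i assume i: "i < length ((fib_morphism ^^ k) [0])"
  have "((fib_morphism ^^ k) [0]) ! i = ((fib_morphism ^^ i) [0]) ! i"
  proof (cases "k \<le> i")
    case True
    from fib_iterate_prefix[OF this] i show ?thesis by (auto simp: prefix_def nth_append)
  next
    case False
    then have "i \<le> k" by simp
    from fib_iterate_prefix[OF this] fib_iterate_long[of i] show ?thesis
      by (auto simp: prefix_def nth_append)
  qed
  then show "((fib_morphism ^^ k) [0]) ! i =
      map fib_word [0..<length ((fib_morphism ^^ k) [0])] ! i"
    using i by (simp add: fib_word_def)
qed simp

lemma fib_word_0: "fib_word 0 = 0"
  by (simp add: fib_word_def)

lemma prefix_map_upt: "m \<le> n \<Longrightarrow> prefix (map f [0..<m]) (map f [0..<n])"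
  by (metis le_add_diff_inverse map_append prefixI upt_add_eq_append zero_le)

lemma prefix_of_map_upt:
  assumes "prefix u (map f [0..<n])"
  shows "u = map f [0..<length u]"
proof -
  have "u = take (length u) (map f [0..<n])"
    using assms by (metis append_eq_conv_conj prefix_def)
  moreover have "length u \<le> n"
    using prefix_length_le[OF assms] by simp
  ultimately show ?thesis by (metis add_0 take_map take_upt)
qed

theorem fib_word_fixed_point:
  "fib_morphism (map fib_word [0..<n]) =
     map fib_word [0..<length (fib_morphism (map fib_word [0..<n]))]"
proof -
  have "n \<le> length ((fib_morphism ^^ n) [0])" using fib_iterate_long[of n] by simp
  then have "prefix (map fib_word [0..<n]) ((fib_morphism ^^ n) [0])"
    by (subst fib_iterate_eq_map) (rule prefix_map_upt)
  then have "prefix (fib_morphism (map fib_word [0..<n])) ((fib_morphism ^^ Suc n) [0])"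
    by (auto simp: prefix_def fib_morphism_append)
  then show ?thesis
    by (subst (asm) fib_iterate_eq_map) (rule prefix_of_map_upt)
qed

theorem fib_word_unique:
  assumes "g 0 = 0"
    and fixed: "\<And>n. fib_morphism (map g [0..<n]) =
                    map g [0..<length (fib_morphism (map g [0..<n]))]"
  shows "g = fib_word"
proof
  fix i
  have "(fib_morphism ^^ k) [0] = map g [0..<length ((fib_morphism ^^ k) [0])]" for k
  proof (induction k)
    case 0
    then show ?case using assms(1) by simp
  next
    case (Suc k)
    then show ?case using fixed[of "length ((fib_morphism ^^ k) [0])"] by simp
  qed
  from this[of i] have "((fib_morphism ^^ i) [0]) ! i = g i"
    using fib_iterate_long[of i] by (metis add_0 diff_zero length_upt nth_map nth_upt)
  then show "g i = fib_word i" by (simp add: fib_word_def)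
qed


section \<open>Zeckendorf representations\<close>

text \<open>Digit lists are written with the most significant digit first; the last digit has weight
  \<open>fib 2\<close>.\<close>

definition fib_value :: "nat list \<Rightarrow> nat" where
  "fib_value w = (\<Sum>j<length w. rev w ! j * fib (j + 2))"

definition valid_fib_rep :: "nat list \<Rightarrow> bool" where
  "valid_fib_rep w \<longleftrightarrow> set w \<subseteq> {0, 1} \<and> \<not> sublist [1, 1] w"

definition is_zeckendorf :: "nat \<Rightarrow> nat list \<Rightarrow> bool" where
  "is_zeckendorf n w \<longleftrightarrow>
     valid_fib_rep w \<and> fib_value w = n \<and> (w \<noteq> [] \<longrightarrow> hd w \<noteq> 0)"

definition zeckendorf :: "nat \<Rightarrow> nat list" where
  "zeckendorf n = (THE w. is_zeckendorf n w)"

lemma fib_value_Nil [simp]: "fib_value [] = 0"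
  by (simp add: fib_value_def)

lemma fib_value_Cons [simp]: "fib_value (a # w) = a * fib (length w + 2) + fib_value w"
  by (simp add: fib_value_def nth_append)

lemma valid_fib_rep_Nil [simp]: "valid_fib_rep []"
  by (simp add: valid_fib_rep_def)

lemma valid_fib_rep_Cons:
  "valid_fib_rep (a # w) \<longleftrightarrow>
     valid_fib_rep w \<and> (a = 0 \<or> a = 1 \<and> (w = [] \<or> hd w = 0))"
  by (cases w) (auto simp: valid_fib_rep_def sublist_Cons_right)

lemma fib_value_bound: "valid_fib_rep w \<Longrightarrow> fib_value w < fib (length w + 2)"
proof (induction w rule: length_induct)
  case (1 w)
  show ?case
  proof (cases w)
    case (Cons a v)
    have v: "fib_value v < fib (length v + 2)"
      using 1 Cons by (simp add: valid_fib_rep_Cons)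
    show ?thesis
    proof (cases "a = 0 \<or> v = []")
      case True
      then show ?thesis
        using v 1(2) Cons fib_mono[of "length v + 2" "length v + 3"]
        by (auto simp: valid_fib_rep_Cons numeral_eq_Suc)
    next
      case False
      then obtain u where u: "v = 0 # u" "a = 1" "valid_fib_rep u"
        using 1(2) Cons by (cases v) (auto simp: valid_fib_rep_Cons)
      then have "fib_value u < fib (length u + 2)" using 1(1) Cons by simp
      then show ?thesis using Cons u by simp
    qed
  qed simp
qed

lemma fib_value_inj:
  assumes "valid_fib_rep u" "valid_fib_rep v" "length u = length v" "fib_value u = fib_value v"
  shows "u = v"
  using assms(3,1,2,4)
proof (induction u v rule: list_induct2)
  case (Cons a u b v)
  have "fib_value u < fib (length u + 2)" "fib_value v < fib (length v + 2)"
    using Cons.prems by (meson fib_value_bound valid_fib_rep_Cons)+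
  then have "a = b"
    using Cons.prems Cons.hyps by (auto simp: valid_fib_rep_Cons)
  then show ?case using Cons by (simp add: valid_fib_rep_Cons)
qed simp

lemma is_zeckendorf_unique:
  assumes "is_zeckendorf n u" "is_zeckendorf n v"
  shows "u = v"
proof -
  have *: "length x \<le> length y" if "is_zeckendorf n x" "is_zeckendorf n y" for x y
  proof (rule ccontr)
    assume "\<not> length x \<le> length y"
    then obtain a z where x: "x = a # z" "length y \<le> length z" by (cases x) auto
    have "a = 1" using that x by (auto simp: is_zeckendorf_def valid_fib_rep_Cons)
    then have "fib (length z + 2) \<le> n" using that x by (auto simp: is_zeckendorf_def)
    moreover have "n < fib (length y + 2)"
      using that(2) fib_value_bound[of y] unfolding is_zeckendorf_def by metis
    ultimately show False using fib_mono[of "length y + 2" "length z + 2"] x by simp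
  qed
  from *[OF assms] *[OF assms(2,1)] have "length u = length v" by simp
  then show ?thesis using assms fib_value_inj by (auto simp: is_zeckendorf_def)
qed

lemma valid_fib_rep_exists:
  "n < fib (m + 2) \<Longrightarrow> \<exists>w. length w = m \<and> valid_fib_rep w \<and> fib_value w = n"
proof (induction m arbitrary: n rule: fib.induct)
  case 1
  then show ?case by simp
next
  case 2
  then have "n = 0 \<or> n = 1" by (auto simp: numeral_eq_Suc)
  then show ?case
    by (intro exI[of _ "[n]"]) (auto simp: valid_fib_rep_Cons)
next
  case (3 m)
  show ?case
  proof (cases "n < fib (Suc m + 2)")
    case True
    with 3(1) obtain w where "length w = Suc m" "valid_fib_rep w" "fib_value w = n" by blast
    then show ?thesis by (intro exI[of _ "0 # w"]) (simp add: valid_fib_rep_Cons)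
  next
    case False
    then have "n - fib (Suc m + 2) < fib (m + 2)" using 3(3) by simp
    with 3(2) obtain w where w: "length w = m" "valid_fib_rep w"
      "fib_value w = n - fib (Suc m + 2)" by blast
    then show ?thesis using False
      by (intro exI[of _ "1 # 0 # w"]) (simp add: valid_fib_rep_Cons)
  qed
qed

lemma is_zeckendorf_exists: "\<exists>w. is_zeckendorf n w"
proof -
  have "n < fib (n + 2)" using fib_iterate_long[of n] by (simp add: fib_iterate_length)
  then obtain w where w: "valid_fib_rep w" "fib_value w = n"
    using valid_fib_rep_exists by blast
  have "fib_value (dropWhile (\<lambda>a. a = 0) w) = fib_value w" for w
    by (induction w) auto
  moreover have "valid_fib_rep (dropWhile (\<lambda>a. a = 0) w)"
    using w(1) by (induction w) (auto simp: valid_fib_rep_Cons)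
  ultimately have "is_zeckendorf n (dropWhile (\<lambda>a. a = 0) w)"
    using w hd_dropWhile[of "\<lambda>a. a = 0" w]
    by (metis dropWhile_eq_Nil_conv is_zeckendorf_def)
  then show ?thesis ..
qed

theorem zeckendorf_ex1: "\<exists>!w. is_zeckendorf n w"
  using is_zeckendorf_exists is_zeckendorf_unique by blast

lemma is_zeckendorf_zeckendorf: "is_zeckendorf n (zeckendorf n)"
  unfolding zeckendorf_def by (rule theI') (rule zeckendorf_ex1)


section \<open>Automata with output\<close>

record ('q, 'a, 'd) dfao =
  states :: "'q set"
  alphabet :: "'a set"
  trans :: "'q \<Rightarrow> 'a \<Rightarrow> 'q option"
  start :: 'q
  outputs :: "'d set"
  out :: "'q \<Rightarrow> 'd"

definition is_dfao :: "('q, 'a, 'd) dfao \<Rightarrow> bool" where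
  "is_dfao M \<longleftrightarrow>
     finite (states M) \<and> states M \<noteq> {} \<and>
     finite (alphabet M) \<and>
     (\<forall>q\<in>states M. \<forall>a\<in>alphabet M. \<forall>p. trans M q a = Some p \<longrightarrow> p \<in> states M) \<and>
     start M \<in> states M \<and>
     finite (outputs M) \<and> outputs M \<noteq> {} \<and>
     (\<forall>q\<in>states M. out M q \<in> outputs M)"

primrec delta_star :: "('q, 'a, 'd) dfao \<Rightarrow> 'q \<Rightarrow> 'a list \<Rightarrow> 'q option" where
  "delta_star M q [] = Some q"
| "delta_star M q (a # w) = Option.bind (trans M q a) (\<lambda>p. delta_star M p w)"

definition is_fib_dfao :: "('q, nat, nat) dfao \<Rightarrow> bool" where
  "is_fib_dfao M \<longleftrightarrow>
     is_dfao M \<and> alphabet M = {0, 1} \<and> outputs M = {0, 1} \<and>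
     (\<forall>w. set w \<subseteq> {0, 1} \<and> \<not> valid_fib_rep w \<longrightarrow> delta_star M (start M) w = None)"

definition generates :: "('q, nat, nat) dfao \<Rightarrow> (nat \<Rightarrow> nat) \<Rightarrow> bool" where
  "generates M s \<longleftrightarrow>
     (\<forall>i k. \<exists>q. delta_star M (start M) (replicate k 0 @ zeckendorf i) = Some q \<and> out M q = s i)"

end

theory Submission
  imports Defs
begin

text \<open>
  Replace every Fibonacci number in the representation of \<open>n\<close> by the matching power of the
  conjugate \<open>1 - phi\<close> of the golden ratio.  The resulting number lies in \<open>(-1, phi)\<close>, is
  congruent to \<open>n\<close> modulo \<open>phi + 1\<close>, and exceeds \<open>phi - 1\<close> iff the last digit is \<open>1\<close>.
  Hence the letter at \<open>i + c\<close> depends only on how the conjugate value of \<open>i\<close> compares with three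
  thresholds in \<open>\<int>[phi]\<close>.  Comparing the value of \<open>w @ [a]\<close> with a threshold reduces to comparing
  that of \<open>w\<close> with a pulled-back threshold, so it suffices to remember the last digit and the
  position of the current value among the orbits of the three thresholds.  Pulling back keeps
  thresholds bounded and contracts their conjugates, initially \<open>O(c)\<close>, by the factor \<open>1 / phi\<close>;
  after \<open>O(log c)\<close> steps an orbit enters a fixed finite set.
\<close>

section \<open>Automata from right-invariant labellings\<close>

lemma delta_star_append:
  "delta_star M q (u @ v) = Option.bind (delta_star M q u) (\<lambda>p. delta_star M p v)"
proof (induction u arbitrary: q)
  case (Cons a u)
  then show ?case by (cases "trans M q a") auto
qed simp

lemma valid_fib_rep_snoc:
  "valid_fib_rep (w @ [a]) \<longleftrightarrow>
     valid_fib_rep w \<and> (a = 0 \<or> a = 1 \<and> (w = [] \<or> last w = 0))"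
proof (induction w)
  case (Cons b w)
  then show ?case by (cases w) (auto simp: valid_fib_rep_Cons)
qed (auto simp: valid_fib_rep_Cons)

lemma valid_replicate_zeckendorf: "valid_fib_rep (replicate k 0 @ zeckendorf i)"
  using is_zeckendorf_zeckendorf[of i]
  by (induction k) (auto simp: is_zeckendorf_def valid_fib_rep_Cons)

lemma fib_value_replicate_zeckendorf: "fib_value (replicate k 0 @ zeckendorf i) = i"
  using is_zeckendorf_zeckendorf[of i]
  by (induction k) (auto simp: is_zeckendorf_def)

text \<open>A Myhill-Nerode construction: the attained labels are the states, and
  \<open>step\<close> makes a move independent of the representative \<open>r q a\<close>. As
  \<open>step\<close> also transfers validity, forbidden digits have no transition.\<close>

lemma fib_dfao_of_labelling:
  fixes h :: "nat list \<Rightarrow> nat" and s :: "nat \<Rightarrow> nat"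
  assumes bound: "\<And>w. valid_fib_rep w \<Longrightarrow> h w < N"
    and step: "\<And>u w a. \<lbrakk>valid_fib_rep (u @ [a]); valid_fib_rep w; h u = h w\<rbrakk> \<Longrightarrow>
      valid_fib_rep (w @ [a]) \<and> h (u @ [a]) = h (w @ [a])"
    and agree: "\<And>u w. \<lbrakk>valid_fib_rep u; valid_fib_rep w; h u = h w\<rbrakk> \<Longrightarrow>
      s (fib_value u) = s (fib_value w)"
    and binary: "\<And>i. s i \<in> {0, 1}"
  shows "\<exists>M :: (nat, nat, nat) dfao.
    is_fib_dfao M \<and> generates M s \<and> card (states M) \<le> N"
proof -
  define r where "r q a = (SOME u. valid_fib_rep (u @ [a]) \<and> h u = q)" for q a
  define M :: "(nat, nat, nat) dfao" where
    "M = \<lparr>states = h ` Collect valid_fib_rep, alphabet = {0, 1},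
      trans = (\<lambda>q a. if \<exists>u. valid_fib_rep (u @ [a]) \<and> h u = q
                     then Some (h (r q a @ [a])) else None),
      start = h [], outputs = {0, 1},
      out = (\<lambda>q. s (fib_value (SOME u. valid_fib_rep u \<and> h u = q)))\<rparr>"
  have r: "valid_fib_rep (r q a @ [a]) \<and> h (r q a) = q"
    if "valid_fib_rep (u @ [a])" "h u = q" for u q a
    unfolding r_def by (rule someI[of _ u]) (use that in simp)
  have trans_valid: "trans M (h w) a = Some (h (w @ [a]))" if "valid_fib_rep (w @ [a])" for w a
  proof -
    have "h (r (h w) a @ [a]) = h (w @ [a])"
      using r[OF that refl] step[of "r (h w) a" a w] that by (auto simp: valid_fib_rep_snoc)
    then show ?thesis using that by (auto simp: M_def)
  qed
  have trans_invalid: "trans M (h w) a = None"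
    if "valid_fib_rep w" "\<not> valid_fib_rep (w @ [a])" for w a
    using that step by (auto simp: M_def)
  have run: "delta_star M (start M) w = (if valid_fib_rep w then Some (h w) else None)" for w
  proof (induction w rule: rev_induct)
    case Nil
    then show ?case by (simp add: M_def)
  next
    case (snoc a w)
    show ?case
    proof (cases "valid_fib_rep w")
      case True
      then show ?thesis
        using snoc trans_valid[of w a] trans_invalid[of w a] by (auto simp: delta_star_append)
    next
      case False
      then show ?thesis
        using snoc by (simp add: delta_star_append valid_fib_rep_snoc)
    qed
  qed
  have sub: "states M \<subseteq> {..<N}" using bound by (auto simp: M_def)
  then have "finite (states M)" by (rule finite_subset) simp
  moreover have "p \<in> states M" if "trans M q a = Some p" for p q a
    using that r by (fastforce simp: M_def split: if_splits)
  ultimately have "is_fib_dfao M"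
    using run binary unfolding is_fib_dfao_def is_dfao_def
    by (auto simp: M_def intro!: image_eqI[of _ _ "[]"] exI[of _ "[]"])
  moreover have out: "out M (h w) = s (fib_value w)" if "valid_fib_rep w" for w
  proof -
    let ?u = "SOME u. valid_fib_rep u \<and> h u = h w"
    have "valid_fib_rep ?u \<and> h ?u = h w" by (rule someI[of _ w]) (use that in simp)
    then show ?thesis using agree[of ?u w] that by (simp add: M_def)
  qed
  have "generates M s"
    unfolding generates_def
    using run out valid_replicate_zeckendorf fib_value_replicate_zeckendorf by simp
  moreover have "card (states M) \<le> N" using card_mono[OF _ sub] by simp
  ultimately show ?thesis by blast
qed

section \<open>Conjugate values of Zeckendorf representations\<close>

definition phi :: real where "phi = (1 + sqrt 5) / 2"

lemma phi_square: "phi * phi = phi + 1"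
  by (simp add: phi_def field_simps)

lemma phi_phi_mult: "phi * (phi * x) = phi * x + x"
  by (simp add: phi_square distrib_right flip: mult.assoc)

lemma phi_bounds: "3 / 2 < phi" "phi < 2"
proof -
  have "2 < sqrt 5" "sqrt 5 < 3" by (auto intro: real_less_rsqrt real_less_lsqrt)
  then show "3 / 2 < phi" "phi < 2" by (auto simp: phi_def)
qed

definition conj_value :: "nat list \<Rightarrow> real" where
  "conj_value w = horner_sum real (1 - phi) (rev w)"

lemma conj_value_Nil [simp]: "conj_value [] = 0"
  by (simp add: conj_value_def)

lemma conj_value_snoc: "conj_value (w @ [a]) = real a + (1 - phi) * conj_value w"
  by (simp add: conj_value_def)

lemma conj_value_Cons: "conj_value (a # w) = real a * (1 - phi) ^ length w + conj_value w"
  by (simp add: conj_value_def horner_sum_append)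

text \<open>The inverse of \<open>1 - phi\<close> is \<open>- phi\<close>, and multiplying by this
  negative number reverses inequalities.\<close>

lemma scaled_less_iff:
  "(1 - phi) * x < y \<longleftrightarrow> - phi * y < x" "y < (1 - phi) * x \<longleftrightarrow> x < - phi * y"
proof -
  have "- phi * ((1 - phi) * x) = (phi * phi - phi) * x" by (simp add: algebra_simps)
  then have *: "- phi * ((1 - phi) * x) = x" using phi_square by simp
  have "- phi * y < - phi * ((1 - phi) * x) \<longleftrightarrow> (1 - phi) * x < y"
    "- phi * ((1 - phi) * x) < - phi * y \<longleftrightarrow> y < (1 - phi) * x"
    using phi_bounds by simp_all
  then show "(1 - phi) * x < y \<longleftrightarrow> - phi * y < x" "y < (1 - phi) * x \<longleftrightarrow> x < - phi * y"
    unfolding * by auto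
qed

text \<open>The third claim feeds the induction: a digit \<open>1\<close> can only follow a value
  below \<open>phi - 1\<close>, which puts the new value above \<open>phi - 1\<close>.\<close>

lemma conj_value_bounds:
  assumes "valid_fib_rep w"
  shows "- 1 < conj_value w" "conj_value w < phi"
    and "(if w \<noteq> [] \<and> last w = 1 then phi - 1 < conj_value w else conj_value w < phi - 1)"
proof -
  have "- 1 < conj_value w \<and> conj_value w < phi \<and>
    (if w \<noteq> [] \<and> last w = 1 then phi - 1 < conj_value w else conj_value w < phi - 1)"
    using assms
  proof (induction w rule: rev_induct)
    case Nil
    then show ?case using phi_bounds by simp
  next
    case (snoc a w)
    let ?v = "conj_value w"
    have a: "valid_fib_rep w" "a = 0 \<or> a = 1 \<and> (w = [] \<or> last w = 0)"
      using snoc.prems by (auto simp: valid_fib_rep_snoc)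
    then have v: "- 1 < ?v" "?v < phi" "a = 1 \<Longrightarrow> ?v < phi - 1"
      using snoc.IH by (auto split: if_splits)
    have "- 1 < (1 - phi) * ?v" using v(2) by (simp add: scaled_less_iff)
    moreover have "(1 - phi) * ?v < phi - 1"
      unfolding scaled_less_iff using v(1) by (simp add: phi_square algebra_simps)
    moreover have "phi - 2 < (1 - phi) * ?v" if "a = 1"
      unfolding scaled_less_iff using v(3)[OF that] by (simp add: phi_square algebra_simps)
    ultimately show ?case using a phi_bounds by (auto simp: conj_value_snoc)
  qed
  then show "- 1 < conj_value w" "conj_value w < phi"
    "(if w \<noteq> [] \<and> last w = 1 then phi - 1 < conj_value w else conj_value w < phi - 1)"
    by auto
qed

text \<open>Both sides satisfy the Fibonacci recurrence in \<open>j\<close>. Hence the digit weights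
  \<open>fib (j + 2)\<close> and \<open>(1 - phi) ^ j\<close> agree modulo
  \<open>phi + 1\<close>.\<close>

lemma conj_power: "(1 - phi) ^ j = real (fib (j + 2)) - (phi + 1) * real (fib j)"
proof (induction j rule: fib.induct)
  case (3 j)
  have "(1 - phi) ^ Suc (Suc j) = (1 - phi) ^ Suc j + (1 - phi) ^ j"
    by (simp add: phi_square phi_phi_mult algebra_simps)
  also have "\<dots> = real (fib (Suc j + 2) + fib (j + 2)) - (phi + 1) * real (fib (Suc j) + fib j)"
    unfolding 3 by (simp add: distrib_left)
  finally show ?case by simp
qed (simp_all add: numeral_eq_Suc)

text \<open>The bound on \<open>m\<close> later keeps the Galois conjugates of the thresholds linear
  in the shift.\<close>

lemma conj_value_eq:
  "\<exists>m \<le> fib_value w. conj_value w = real (fib_value w) - (phi + 1) * real m"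
proof (induction w)
  case (Cons a w)
  then obtain m where m: "m \<le> fib_value w"
    "conj_value w = real (fib_value w) - (phi + 1) * real m" by blast
  have "a * fib (length w) \<le> a * fib (length w + 2)"
    by (intro mult_left_mono fib_mono) auto
  with m show ?case
    by (intro exI[of _ "a * fib (length w) + m"])
      (simp add: conj_value_Cons conj_power algebra_simps)
qed simp

section \<open>The Fibonacci word and the last digit\<close>

text \<open>Iterate \<open>k + 2\<close> of the morphism is iterate \<open>k + 1\<close>, of length
  \<open>fib (k + 3)\<close>, followed by iterate \<open>k\<close>.\<close>

lemma fib_word_add_fib:
  assumes "i < fib (k + 2)"
  shows "fib_word (fib (k + 3) + i) = fib_word i"
proof -
  define I where "I n = (fib_morphism ^^ n) [0]" for n
  have nth: "I n ! j = fib_word j" if "j < fib (n + 2)" for n j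
    using that unfolding I_def
    by (subst fib_iterate_eq_map) (simp add: fib_iterate_length)
  have "I (Suc (Suc k)) = I (Suc k) @ I k"
    unfolding I_def by (rule fib_iterate_Suc_Suc)
  moreover have "length (I (Suc k)) = fib (k + 3)"
    unfolding I_def by (subst fib_iterate_length) (simp add: numeral_eq_Suc)
  ultimately have "I (Suc (Suc k)) ! (fib (k + 3) + i) = I k ! i"
    by (simp add: nth_append)
  moreover have "fib (k + 3) + i < fib (Suc (Suc k) + 2)"
    using assms by (simp add: numeral_eq_Suc)
  ultimately show ?thesis using nth assms by metis
qed

text \<open>Leading digits are stripped: in a longer word a leading \<open>1\<close> is followed by
  \<open>0\<close>, so the rest is small enough for \<open>fib_word_add_fib\<close>.\<close>

lemma fib_word_fib_value:
  assumes "valid_fib_rep w"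
  shows "fib_word (fib_value w) = (if w \<noteq> [] \<and> last w = 1 then 1 else 0)"
  using assms
proof (induction w)
  case Nil
  then show ?case by (simp add: fib_word_0)
next
  case (Cons a w)
  show ?case
  proof (cases w)
    case Nil
    then show ?thesis using Cons.prems
      by (auto simp: valid_fib_rep_Cons fib_word_0 numeral_eq_Suc fib_word_def fib_morphism_def)
  next
    case w: (Cons b u)
    show ?thesis
    proof (cases "a = 0")
      case True
      then show ?thesis using Cons w by (simp add: valid_fib_rep_Cons)
    next
      case False
      with Cons.prems w have "a = 1" "b = 0" "valid_fib_rep w" "valid_fib_rep u"
        by (auto simp: valid_fib_rep_Cons)
      then show ?thesis
        using Cons.IH w fib_word_add_fib[OF fib_value_bound[of u]]
        by (simp add: numeral_eq_Suc)
    qed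
  qed
qed

lemma fib_word_binary: "fib_word i \<in> {0, 1}"
  using fib_word_fib_value[OF valid_replicate_zeckendorf[of 0 i]]
  by (simp only: fib_value_replicate_zeckendorf) simp

lemma fib_word_iff:
  assumes "valid_fib_rep w"
  shows "fib_word (fib_value w) = 1 \<longleftrightarrow> phi - 1 < conj_value w"
  using fib_word_fib_value[OF assms] conj_value_bounds(3)[OF assms] by (auto split: if_splits)

text \<open>Modulo \<^term>\<open>phi + 1\<close> the conjugate value of a representation of \<open>n\<close> is \<open>n\<close>
  itself, so conjugate values are additive up to a multiple \<open>e\<close> of this period.\<close>

lemma fib_word_add_iff:
  assumes u: "valid_fib_rep u" and w: "valid_fib_rep w"
  shows "fib_word (fib_value u + fib_value w) = 1 \<longleftrightarrow>
    phi - 1 < conj_value u + conj_value w \<and> conj_value u + conj_value w < phi \<or>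
    conj_value u + conj_value w < - 1"
proof -
  define z where "z = replicate 0 0 @ zeckendorf (fib_value u + fib_value w)"
  have z: "valid_fib_rep z" "fib_value z = fib_value u + fib_value w"
    unfolding z_def
    by (rule valid_replicate_zeckendorf, rule fib_value_replicate_zeckendorf)
  from conj_value_eq[of u] conj_value_eq[of w] conj_value_eq[of z] obtain k l m where
    "conj_value u = real (fib_value u) - (phi + 1) * real k"
    "conj_value w = real (fib_value w) - (phi + 1) * real l"
    "conj_value z = real (fib_value z) - (phi + 1) * real m" by blast
  then have "conj_value z = conj_value u + conj_value w + (phi + 1) * of_int (int k + int l - int m)"
    by (simp add: z algebra_simps)
  then obtain e :: int where e: "conj_value z = conj_value u + conj_value w + (phi + 1) * of_int e"
    by blast
  note b = conj_value_bounds(1,2)[OF u] conj_value_bounds(1,2)[OF w] conj_value_bounds(1,2)[OF z(1)]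
  have "e < 2"
  proof (rule ccontr)
    assume "\<not> e < 2"
    then have "(phi + 1) * 2 \<le> (phi + 1) * of_int e"
      using phi_bounds by (intro mult_left_mono) auto
    then show False using b e phi_bounds by argo
  qed
  moreover have "- 2 < e"
  proof (rule ccontr)
    assume "\<not> - 2 < e"
    then have "(phi + 1) * of_int e \<le> (phi + 1) * (- 2)"
      using phi_bounds by (intro mult_left_mono) auto
    then show False using b e phi_bounds by argo
  qed
  \<comment> \<open>For \<open>e = 1\<close> the sum is below \<open>- 1\<close> and the letter is
    \<open>1\<close>; for \<open>e = - 1\<close> the sum exceeds \<open>phi\<close> and the letter
    is \<open>0\<close>.\<close>
  ultimately consider "e = 0" | "e = 1" | "e = - 1" by linarith
  then have "phi - 1 < conj_value z \<longleftrightarrow>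
    phi - 1 < conj_value u + conj_value w \<and> conj_value u + conj_value w < phi \<or>
    conj_value u + conj_value w < - 1"
    by cases (use b e phi_bounds in auto)
  then show ?thesis using fib_word_iff[OF z(1)] z(2) by simp
qed

section \<open>Thresholds and their backward orbits\<close>

text \<open>Comparing the conjugate value of \<open>w @ [a]\<close> with \<open>x\<close> amounts to comparing that of \<open>w\<close> with
  \<open>- phi * (x - a)\<close>.  Only one of the two digits \<open>a\<close> makes this a nontrivial question;
  outside the range of conjugate values no digit does, and \<open>0\<close> serves as a dummy.\<close>

definition pull_back :: "real \<Rightarrow> real" where
  "pull_back x =
     (if - 1 \<le> x \<and> x \<le> phi - 1 then - phi * x
      else if phi - 1 < x \<and> x \<le> phi then - phi * (x - 1)
      else 0)"

lemma pull_back_bounds: "\<bar>pull_back x\<bar> \<le> 2"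
proof -
  have "\<bar>- phi * y\<bar> \<le> phi" if "\<bar>y\<bar> \<le> 1" for y
    using mult_left_mono[OF that, of phi] phi_bounds by (simp add: abs_mult)
  then have "\<bar>- phi * y\<bar> \<le> 2" if "\<bar>y\<bar> \<le> 1" for y
    using that phi_bounds by (meson less_imp_le order_trans)
  then show ?thesis using phi_bounds unfolding pull_back_def by auto
qed

lemma compare_snoc:
  assumes "valid_fib_rep (u @ [a])" "valid_fib_rep (w @ [a])"
    and "pull_back x < conj_value u \<longleftrightarrow> pull_back x < conj_value w"
    and "conj_value u < pull_back x \<longleftrightarrow> conj_value w < pull_back x"
  shows "(x < conj_value (u @ [a]) \<longleftrightarrow> x < conj_value (w @ [a])) \<and>
    (conj_value (u @ [a]) < x \<longleftrightarrow> conj_value (w @ [a]) < x)"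
proof -
  note b = conj_value_bounds[OF assms(1)] conj_value_bounds[OF assms(2)]
  have a: "a = 0 \<or> a = 1" using assms(1) by (auto simp: valid_fib_rep_snoc)
  \<comment> \<open>In the first four cases \<open>x\<close> lies outside the open range of values
    ending in \<open>a\<close>, so the bounds decide both comparisons.\<close>
  consider "x < - 1" | "phi < x" | "a = 0" "phi - 1 < x" | "a = 1" "x \<le> phi - 1"
    | "a = 0" "- 1 \<le> x" "x \<le> phi - 1" | "a = 1" "phi - 1 < x" "x \<le> phi"
    using a by linarith
  then show ?thesis
  proof cases
    case 5
    then show ?thesis using assms(3,4)
      by (simp add: conj_value_snoc pull_back_def scaled_less_iff)
  next
    case 6
    have "x < 1 + (1 - phi) * v \<longleftrightarrow> v < - phi * (x - 1)"
      "1 + (1 - phi) * v < x \<longleftrightarrow> - phi * (x - 1) < v" for v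
      unfolding scaled_less_iff[symmetric] by (simp_all add: less_diff_eq diff_less_eq add.commute)
    then show ?thesis using 6 assms(3,4) by (simp add: conj_value_snoc pull_back_def)
  qed (use b in auto)
qed

section \<open>Elements of Z[phi] with bounded conjugate\<close>

text \<open>The Galois conjugate of \<open>A + B * (1 - phi)\<close> is
  \<open>A + B * phi\<close>.\<close>

definition conj_bounded :: "real \<Rightarrow> real set" where
  "conj_bounded M = {of_int A + of_int B * (1 - phi) | A B. \<bar>of_int A + of_int B * phi\<bar> \<le> M}"

lemma conj_boundedI:
  "x = of_int A + of_int B * (1 - phi) \<Longrightarrow> \<bar>of_int A + of_int B * phi\<bar> \<le> M \<Longrightarrow> x \<in> conj_bounded M"
  unfolding conj_bounded_def by blast

text \<open>Conjugation turns the factor \<open>- phi\<close> into \<open>phi - 1 = 1 / phi\<close>,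
  and the subtracted digit costs at most \<open>1\<close>.\<close>

lemma pull_back_conj_bounded:
  assumes "x \<in> conj_bounded M"
  shows "pull_back x \<in> conj_bounded ((M + 1) / phi)"
proof -
  obtain A B where x: "x = of_int A + of_int B * (1 - phi)" "\<bar>of_int A + of_int B * phi\<bar> \<le> M"
    using assms by (auto simp: conj_bounded_def)
  have pos: "0 \<le> (M + 1) / phi" using x(2) phi_bounds by simp
  \<comment> \<open>The witnesses come from \<open>- phi = (1 - phi) - 1\<close> and
    \<open>- phi * (1 - phi) = 1\<close>.\<close>
  have *: "- phi * (x - of_int a) \<in> conj_bounded ((M + 1) / phi)" if "a \<in> {0, 1}" for a
  proof (rule conj_boundedI[of _ "B - (A - a)" "A - a"])
    show "- phi * (x - of_int a) =
        of_int (B - (A - a)) + of_int (A - a) * (1 - phi)"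
      by (simp add: x(1) phi_square phi_phi_mult algebra_simps)
    have "phi * (of_int (B - (A - a)) + of_int (A - a) * phi) =
        of_int A + of_int B * phi - of_int a"
      by (simp add: phi_square phi_phi_mult algebra_simps)
    then have "\<bar>phi * (of_int (B - (A - a)) + of_int (A - a) * phi)\<bar> \<le> M + 1"
      using x(2) that by auto
    then show "\<bar>of_int (B - (A - a)) + of_int (A - a) * phi\<bar> \<le> (M + 1) / phi"
      unfolding abs_mult using phi_bounds by (simp only: pos_le_divide_eq mult.commute)
  qed
  moreover have "0 \<in> conj_bounded ((M + 1) / phi)"
    using pos by (intro conj_boundedI[of _ 0 0]) auto
  ultimately show ?thesis
    using *[of 0] *[of 1] by (auto simp: pull_back_def)
qed

lemma conj_bounded_mono: "M \<le> N \<Longrightarrow> conj_bounded M \<subseteq> conj_bounded N"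
  unfolding conj_bounded_def by (auto, metis order_trans)

text \<open>The map sending \<open>M\<close> to \<open>(M + 1) / phi\<close> has fixed point
  \<open>phi\<close>, and the excess over it shrinks geometrically.\<close>

lemma funpow_pull_back_conj_bounded:
  assumes "x \<in> conj_bounded M"
  shows "(pull_back ^^ k) x \<in> conj_bounded (M / phi ^ k + phi)"
proof (induction k)
  case 0
  then show ?case using assms conj_bounded_mono[of M "M + phi"] phi_bounds by auto
next
  case (Suc k)
  have "(M / phi ^ k + phi + 1) / phi = M / phi ^ Suc k + phi"
    using phi_bounds by (simp add: phi_phi_mult field_simps)
  then show ?case using pull_back_conj_bounded[OF Suc.IH] by simp
qed

text \<open>An element and its conjugate differ by \<open>B * (2 * phi - 1)\<close>, so bounding
  both bounds \<open>B\<close> and then \<open>A\<close>.\<close>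

lemma finite_conj_bounded: "finite {x \<in> conj_bounded M. \<bar>x\<bar> \<le> C}"
proof -
  let ?D = "{- \<lceil>M + C\<rceil> .. \<lceil>M + C\<rceil>}" and ?E = "{- \<lceil>M + 2 * (M + C)\<rceil> .. \<lceil>M + 2 * (M + C)\<rceil>}"
  let ?f = "\<lambda>(A, B). real_of_int A + of_int B * (1 - phi)"
  have "{x \<in> conj_bounded M. \<bar>x\<bar> \<le> C} \<subseteq> ?f ` (?E \<times> ?D)"
  proof
    fix x assume "x \<in> {x \<in> conj_bounded M. \<bar>x\<bar> \<le> C}"
    then obtain A B where x: "x = of_int A + of_int B * (1 - phi)" "\<bar>of_int A + of_int B * phi\<bar> \<le> M"
      "\<bar>x\<bar> \<le> C" by (auto simp: conj_bounded_def)
    have "of_int B * (2 * phi - 1) = of_int A + of_int B * phi - x"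
      using x(1) by (simp add: algebra_simps)
    then have "\<bar>of_int B * (2 * phi - 1)\<bar> \<le> M + C" using x(2,3) by linarith
    moreover have "\<bar>of_int B\<bar> * 1 \<le> \<bar>of_int B\<bar> * (2 * phi - 1)"
      using phi_bounds by (intro mult_left_mono) auto
    ultimately have B: "\<bar>real_of_int B\<bar> \<le> M + C"
      using phi_bounds by (simp add: abs_mult)
    have "\<bar>of_int B * phi\<bar> \<le> (M + C) * 2"
      unfolding abs_mult using B phi_bounds by (intro mult_mono) auto
    then have "\<bar>real_of_int A\<bar> \<le> M + 2 * (M + C)" using x(2) by linarith
    then have "A \<in> ?E" by (simp, linarith)
    moreover have "B \<in> ?D" using B by (simp, linarith)
    ultimately show "x \<in> ?f ` (?E \<times> ?D)" using x(1) by force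
  qed
  then show ?thesis by (rule finite_subset) simp
qed

section \<open>Orbits of logarithmic size\<close>

definition orbit :: "real \<Rightarrow> real set" where
  "orbit x = range (\<lambda>k. (pull_back ^^ k) x)"

lemma orbit_refl: "x \<in> orbit x"
  unfolding orbit_def by (rule range_eqI[of _ _ 0]) simp

lemma pull_back_orbit: "y \<in> orbit x \<Longrightarrow> pull_back y \<in> orbit x"
  unfolding orbit_def by (metis (no_types, lifting) funpow.simps(2) o_apply rangeE rangeI)

text \<open>A finite set independent of the shift; the slack \<open>1\<close> over the limit
  \<open>phi\<close> is what makes every orbit enter it.\<close>

definition core :: "real set" where
  "core = {x \<in> conj_bounded (1 + phi). \<bar>x\<bar> \<le> 2}"

lemma orbit_card:
  assumes "x \<in> conj_bounded M" "M \<le> phi ^ L"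
  shows "finite (orbit x)" "card (orbit x) \<le> Suc L + card core"
proof -
  \<comment> \<open>Strictness gives \<open>k > 0\<close>, so the iterate is a value of
    \<open>pull_back\<close> and the bound \<open>2\<close> applies; \<open>x\<close> itself may be
    larger.\<close>
  have "(pull_back ^^ k) x \<in> core" if "L < k" for k
  proof -
    have "phi ^ L \<le> phi ^ k" using that phi_bounds by (intro power_increasing) auto
    then have "M \<le> phi ^ k" using assms(2) by linarith
    then have "M / phi ^ k + phi \<le> 1 + phi" using phi_bounds by (simp add: field_simps)
    then have "(pull_back ^^ k) x \<in> conj_bounded (1 + phi)"
      using funpow_pull_back_conj_bounded[OF assms(1)] conj_bounded_mono by blast
    moreover have "\<bar>(pull_back ^^ k) x\<bar> \<le> 2"
      using that pull_back_bounds by (cases k) auto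
    ultimately show ?thesis by (simp add: core_def)
  qed
  then have sub: "orbit x \<subseteq> (\<lambda>k. (pull_back ^^ k) x) ` {..L} \<union> core"
    unfolding orbit_def using not_le by blast
  have fin: "finite core" unfolding core_def by (rule finite_conj_bounded)
  then show "finite (orbit x)" using finite_subset[OF sub] by simp
  have "card (orbit x) \<le> card ((\<lambda>k. (pull_back ^^ k) x) ` {..L} \<union> core)"
    using fin by (intro card_mono sub) simp
  also have "\<dots> \<le> card ((\<lambda>k. (pull_back ^^ k) x) ` {..L}) + card core"
    by (rule card_Un_le)
  also have "\<dots> \<le> Suc L + card core"
    using card_image_le[of "{..L}" "\<lambda>k. (pull_back ^^ k) x"] by simp
  finally show "card (orbit x) \<le> Suc L + card core" .
qed

section \<open>Positions relative to a finite set\<close>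

text \<open>Gaps get even numbers and points of \<open>P\<close> odd ones, so the number of labels
  is linear in \<open>card P\<close>.\<close>

definition position :: "real set \<Rightarrow> real \<Rightarrow> nat" where
  "position P v = card {t \<in> P. t < v} + card {t \<in> P. t \<le> v}"

lemma position_le: "finite P \<Longrightarrow> position P v \<le> 2 * card P"
  unfolding position_def
  using card_mono[of P "{t \<in> P. t < v}"] card_mono[of P "{t \<in> P. t \<le> v}"] by simp

text \<open>Both counts grow with \<open>v\<close>, so equal sums force equal counts, and nested
  finite sets of equal size coincide.\<close>

lemma position_eq_iff:
  assumes "finite P"
  shows "position P v = position P w \<longleftrightarrow>
    (\<forall>t\<in>P. (t < v \<longleftrightarrow> t < w) \<and> (v < t \<longleftrightarrow> w < t))"
proof
  have *: "\<forall>t\<in>P. (t < v \<longleftrightarrow> t < w) \<and> (v < t \<longleftrightarrow> w < t)"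
    if "v \<le> w" "position P v = position P w" for v w
  proof -
    have "{t \<in> P. t < v} \<subseteq> {t \<in> P. t < w}" "{t \<in> P. t \<le> v} \<subseteq> {t \<in> P. t \<le> w}"
      using that(1) by auto
    moreover from this have "card {t \<in> P. t < v} \<le> card {t \<in> P. t < w}"
      "card {t \<in> P. t \<le> v} \<le> card {t \<in> P. t \<le> w}"
      using assms by (simp_all add: card_mono)
    then have "card {t \<in> P. t < v} = card {t \<in> P. t < w}"
      "card {t \<in> P. t \<le> v} = card {t \<in> P. t \<le> w}"
      using that(2) by (simp_all add: position_def)
    ultimately have "{t \<in> P. t < v} = {t \<in> P. t < w}" "{t \<in> P. t \<le> v} = {t \<in> P. t \<le> w}"
      using assms by (simp_all add: card_subset_eq)
    then show ?thesis by (metis (mono_tags, lifting) mem_Collect_eq not_less)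
  qed
  assume "position P v = position P w"
  then show "\<forall>t\<in>P. (t < v \<longleftrightarrow> t < w) \<and> (v < t \<longleftrightarrow> w < t)"
    using *[of v w] *[of w v] by (metis linear)
next
  assume "\<forall>t\<in>P. (t < v \<longleftrightarrow> t < w) \<and> (v < t \<longleftrightarrow> w < t)"
  then have "{t \<in> P. t < v} = {t \<in> P. t < w}" "{t \<in> P. t \<le> v} = {t \<in> P. t \<le> w}"
    unfolding not_less[symmetric] by blast+
  then show "position P v = position P w" by (simp add: position_def)
qed

section \<open>The shifted Fibonacci word\<close>

lemma shifted_fib_word_dfao:
  assumes "real c + 2 \<le> phi ^ L"
  shows "\<exists>M :: (nat, nat, nat) dfao. is_fib_dfao M \<and> generates M (\<lambda>i. fib_word (i + c)) \<and>
    card (states M) \<le> 12 * (Suc L + card core) + 2"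
proof -
  define z where "z = replicate 0 0 @ zeckendorf c"
  have z: "valid_fib_rep z" "fib_value z = c"
    unfolding z_def
    by (rule valid_replicate_zeckendorf, rule fib_value_replicate_zeckendorf)
  define v where "v = conj_value z"
  \<comment> \<open>The starting points are the three bounds in \<open>fib_word_add_iff\<close> with
    \<open>v\<close> moved across.\<close>
  define P where "P = orbit (phi - 1 - v) \<union> orbit (phi - v) \<union> orbit (- 1 - v)"
  obtain m where m: "m \<le> c" "v = real c - (phi + 1) * real m"
    using conj_value_eq[of z] z(2) by (auto simp: v_def)
  have "0 \<le> (2 - phi) * real m" "(2 - phi) * real m \<le> 1 * real c"
    using m(1) phi_bounds by (simp, intro mult_mono) auto
  \<comment> \<open>The middle expression is the conjugate of \<open>v\<close>. The constants
    \<open>phi - 1\<close>, \<open>phi\<close> and \<open>- 1\<close> have conjugates of size at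
    most \<open>phi < 2\<close>, hence the bound \<open>c + 2\<close> below.\<close>
  then have conj: "0 \<le> real c - 2 * real m + real m * phi"
    "real c - 2 * real m + real m * phi \<le> real c"
    by (simp_all add: algebra_simps)
  have "phi - 1 - v \<in> conj_bounded (real c + 2)"
    by (rule conj_boundedI[of _ "- (int c - 2 * int m)" "- int m - 1"])
      (use m(2) conj phi_bounds in \<open>auto simp: algebra_simps\<close>)
  moreover have "phi - v \<in> conj_bounded (real c + 2)"
    by (rule conj_boundedI[of _ "1 - (int c - 2 * int m)" "- int m - 1"])
      (use m(2) conj phi_bounds in \<open>auto simp: algebra_simps\<close>)
  moreover have "- 1 - v \<in> conj_bounded (real c + 2)"
    by (rule conj_boundedI[of _ "- 1 - (int c - 2 * int m)" "- int m"])
      (use m(2) conj phi_bounds in \<open>auto simp: algebra_simps\<close>)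
  ultimately have orb: "finite (orbit x) \<and> card (orbit x) \<le> Suc L + card core"
    if "x \<in> {phi - 1 - v, phi - v, - 1 - v}" for x
    using that orbit_card[OF _ assms] by blast
  have fin: "finite P" using orb by (simp add: P_def)
  have "card P \<le> card (orbit (phi - 1 - v)) + card (orbit (phi - v)) + card (orbit (- 1 - v))"
    unfolding P_def by (meson add_mono card_Un_le order_refl order_trans)
  then have card: "card P \<le> 3 * (Suc L + card core)"
    using orb[of "phi - 1 - v"] orb[of "phi - v"] orb[of "- 1 - v"] by simp
  have closed: "pull_back t \<in> P" if "t \<in> P" for t
    using that pull_back_orbit by (auto simp: P_def)
  have mem: "phi - 1 - v \<in> P" "phi - v \<in> P" "- 1 - v \<in> P"
    by (simp_all add: P_def orbit_refl)
  \<comment> \<open>The parity of the label stores the last digit, which decides whether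
    \<open>1\<close> may follow.\<close>
  define h where
    "h w = 2 * position P (conj_value w) + (if w \<noteq> [] \<and> last w = 1 then 1 else 0)" for w
  have h_eq: "position P (conj_value u) = position P (conj_value w)"
    "(u \<noteq> [] \<and> last u = 1) = (w \<noteq> [] \<and> last w = 1)" if "h u = h w" for u w
  proof -
    have "a = b \<and> p = q"
      if "2 * a + (if p then 1 else 0) = 2 * b + (if q then 1 else 0)" for a b :: nat and p q
      using that by (cases p; cases q) (simp_all, presburger+)
    from this[OF that[unfolded h_def]]
    show "position P (conj_value u) = position P (conj_value w)"
      "(u \<noteq> [] \<and> last u = 1) = (w \<noteq> [] \<and> last w = 1)" by blast+
  qed
  have "\<exists>M :: (nat, nat, nat) dfao. is_fib_dfao M \<and> generates M (\<lambda>i. fib_word (i + c)) \<and>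
      card (states M) \<le> 4 * card P + 2"
  proof (rule fib_dfao_of_labelling[where h = h])
    fix w
    show "h w < 4 * card P + 2" using position_le[OF fin, of "conj_value w"] by (simp add: h_def)
  next
    fix u w :: "nat list" and a
    assume ua: "valid_fib_rep (u @ [a])" and w: "valid_fib_rep w" and h: "h u = h w"
    have "set w \<subseteq> {0, 1}" using w by (simp add: valid_fib_rep_def)
    then have "w = [] \<or> last w = 0 \<or> last w = 1" using last_in_set by fastforce
    then have wa: "valid_fib_rep (w @ [a])"
      using ua w h_eq(2)[OF h] by (auto simp: valid_fib_rep_snoc)
    have "position P (conj_value (u @ [a])) = position P (conj_value (w @ [a]))"
      unfolding position_eq_iff[OF fin]
    proof
      fix t assume "t \<in> P"
      then have "(pull_back t < conj_value u \<longleftrightarrow> pull_back t < conj_value w) \<and>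
          (conj_value u < pull_back t \<longleftrightarrow> conj_value w < pull_back t)"
        using h_eq(1)[OF h] closed unfolding position_eq_iff[OF fin] by blast
      then show "(t < conj_value (u @ [a]) \<longleftrightarrow> t < conj_value (w @ [a])) \<and>
          (conj_value (u @ [a]) < t \<longleftrightarrow> conj_value (w @ [a]) < t)"
        using compare_snoc[OF ua wa] by blast
    qed
    then show "valid_fib_rep (w @ [a]) \<and> h (u @ [a]) = h (w @ [a])"
      using wa by (simp add: h_def)
  next
    fix u w
    assume u: "valid_fib_rep u" and w: "valid_fib_rep w" and h: "h u = h w"
    have iff: "fib_word (fib_value x + c) = 1 \<longleftrightarrow>
        phi - 1 - v < conj_value x \<and> conj_value x < phi - v \<or> conj_value x < - 1 - v"
      if "valid_fib_rep x" for x
      using fib_word_add_iff[OF that z(1)] unfolding z(2) v_def by auto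
    have "fib_word (fib_value u + c) = 1 \<longleftrightarrow> fib_word (fib_value w + c) = 1"
      unfolding iff[OF u] iff[OF w]
      using h_eq(1)[OF h] mem unfolding position_eq_iff[OF fin] by blast
    then show "fib_word (fib_value u + c) = fib_word (fib_value w + c)"
      using fib_word_binary[of "fib_value u + c"] fib_word_binary[of "fib_value w + c"] by auto
  next
    fix i
    show "fib_word (i + c) \<in> {0, 1}" by (rule fib_word_binary)
  qed
  then show ?thesis using card
    by (elim exE conjE, intro exI conjI) (assumption | linarith)+
qed

theorem theorem3:
  "\<exists>K::real. \<forall>c::nat. \<exists>M::(nat, nat, nat) dfao.
     is_fib_dfao M \<and> generates M (\<lambda>i. fib_word (i + c)) \<and>
     (c \<ge> 2 \<longrightarrow> real (card (states M)) \<le> K * ln (real c))"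
proof -
  \<comment> \<open>Rounding up gives \<open>L \<le> log phi (c + 2) + 1\<close>, so the constants
    add up to \<open>12 + 12 + 2\<close>.\<close>
  define C where "C = 26 + 12 * real (card core)"
  \<comment> \<open>For \<open>c \<ge> 2\<close>, the bound \<open>c + 2 \<le> c ^ 2\<close> doubles
    \<open>12\<close> to \<open>24\<close>, and \<open>ln c \<ge> ln 2\<close> lets the second term
    absorb \<open>C\<close>.\<close>
  define K where "K = 24 / ln phi + C / ln 2"
  have ln_phi: "0 < ln phi" using phi_bounds by simp
  have "\<exists>M :: (nat, nat, nat) dfao.
     is_fib_dfao M \<and> generates M (\<lambda>i. fib_word (i + c)) \<and>
     (c \<ge> 2 \<longrightarrow> real (card (states M)) \<le> K * ln (real c))" for c
  proof -
    define L where "L = nat \<lceil>log phi (real c + 2)\<rceil>"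
    have log_nonneg: "0 \<le> log phi (real c + 2)" using phi_bounds by simp
    have "log phi (real c + 2) \<le> real L" unfolding L_def by linarith
    then have "real c + 2 \<le> phi powr real L"
      using phi_bounds by (simp add: log_le_iff)
    then have "real c + 2 \<le> phi ^ L"
      using phi_bounds by (simp add: powr_realpow)
    from shifted_fib_word_dfao[OF this] obtain M :: "(nat, nat, nat) dfao" where
      M: "is_fib_dfao M" "generates M (\<lambda>i. fib_word (i + c))"
        "card (states M) \<le> 12 * (Suc L + card core) + 2" by blast
    have "real (card (states M)) \<le> K * ln (real c)" if c: "c \<ge> 2"
    proof -
      have "real (card (states M)) \<le> real (12 * (Suc L + card core) + 2)"
        using M(3) by (simp only: of_nat_le_iff)
      also have "\<dots> \<le> 12 * log phi (real c + 2) + C"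
        using log_nonneg unfolding L_def C_def by (simp, linarith)
      also have "ln (real c + 2) \<le> ln (real c ^ 2)"
      proof (subst ln_le_cancel_iff)
        have "2 * real c \<le> real c * real c" using c by (intro mult_right_mono) auto
        moreover have "2 \<le> real c" using c by simp
        ultimately show "real c + 2 \<le> real c ^ 2" unfolding power2_eq_square by linarith
      qed (use c in auto)
      then have "12 * log phi (real c + 2) \<le> 24 / ln phi * ln (real c)"
        using c ln_phi by (simp add: log_def ln_realpow field_simps)
      moreover have "C * 1 \<le> C * (ln (real c) / ln 2)"
        using c by (intro mult_left_mono) (auto simp: C_def)
      ultimately show ?thesis by (simp add: K_def algebra_simps)
    qed
    then show ?thesis using M by blast
  qed
  then show ?thesis by blast
qed

end
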